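(* For any type expression $E$, $etype(E)=\mathit{true}$ if and only if $\mathrm{Empty}(E)$, i.e. $[\![E]\!]_{\Delta}=\emptyset$.
   Context: $\Sigma$ is a finite ranked alphabet of function symbols containing at least one constant; $\mathcal{T}(\Sigma)$ is the set of ground terms over $\Sigma$. $\Pi$ is a finite ranked alphabet of type constructors, disjoint from $\Sigma$ and from $\{\sqcap,\sqcup,\neg,\top,\bot\}$. A type expression is a ground term over $\Pi\cup\{\sqcap,\sqcup,\neg,\top,\bot\}$. $\Delta$ is a finite set of type rules $c(\zeta_1,\dots,\zeta_m)\rightarrow\tau$ with $c\in\Pi$ of arity $m$, distinct parameters $\zeta_i$, and $\tau$ of the form $f(\tau_1,\dots,\tau_n)$, $f\in\Sigma$, each $\tau_j$ either some $\zeta_i$ or $d(\zeta'_1,\dots,\zeta'_k)$ with $d\in\Pi$ and $\zeta'_i\in\{\zeta_1,\dots,\zeta_m\}$. $ground(\Delta)$ is the set of all instances of rules of $\Delta$ obtained by substituting type expressions for parameters, together with $\top\rightarrow f(\top,\dots,\top)$ for every $f\in\Sigma$. The meaning: $[\![\top]\!]_\Delta=\mathcal{T}(\Sigma)$, $[\![\bot]\!]_\Delta=\emptyset$, $\sqcap,\sqcup,\neg$ are intersection, union, complement w.r.t. $\mathcal{T}(\Sigma)$, and for a type atom $\omega$ (a type expression whose principal symbol is in $\Pi$), $[\![\omega]\!]_\Delta=\bigcup_{(\omega\rightarrow f(E_1,\dots,E_n))\in ground(\Delta)}\{f(t_1,\dots,t_n)\mid t_i\in[\![E_i]\!]_\Delta\}$.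 On sequences: $[\![\epsilon]\!]=\{\epsilon\}$, $[\![\langle E\rangle\bullet\theta]\!]=[\![E]\!]\times[\![\theta]\!]$, and a special sequence $\Lambda$ has $[\![\Lambda]\!]=\emptyset$; sequence expressions combine equal-length sequences with $\sqcap,\sqcup,\neg$ (set operations on tuples of terms); a conjunctive sequence expression is $\gamma_1\sqcap\dots\sqcap\gamma_k$ of sequences, with length $\|\Gamma\|$, and $\Gamma|_j=\gamma_1^j\sqcap\dots\sqcap\gamma_k^j$ ($\gamma_i^j$ the $j$-th component). $\mathrm{Empty}(O)$ means $[\![O]\!]_\Delta=\emptyset$. A literal is a type atom or its complement; a conjunctive type expression $C$ is an intersection of literals (without repetitions, containing at least one positive literal, e.g. $\top$); $pos(C)$, $neg(C)$ are its positive atoms and complemented atoms, $lit(C)$ its literals; $C_1\preceq C_2$ iff $lit(C_1)\supseteq lit(C_2)$. $\mathcal{F}(\alpha)=\{f\mid \exists (\alpha\rightarrow f(\dots))\in ground(\Delta)\}$, $\mathcal{A}^f_\alpha=\{\langle\alpha_1,\dots,\alpha_k\rangle\mid(\alpha\rightarrow f(\alpha_1,\dots,\alpha_k))\in ground(\Delta)\}$. $push(\neg(\sqcup_i\gamma_i))=\sqcap_i push(\neg\gamma_i)$, $push(\neg\langle E_1,\dots,E_k\rangle)=\sqcup_{l=1}^k\langle\top,\dots,\top,\neg E_l,\top,\dots,\top\rangle$ ($\neg E_l$ at position $l$), $push(\neg\epsilon)=\Lambda$. $\mathcal{B}^f_C=\big(\sqcap_{\omega\in pos(C)}(\sqcup\mathcal{A}^f_\omega)\big)\sqcap\big(\sqcap_{\tau\in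 neg(C)}push(\neg(\sqcup\mathcal{A}^f_\tau))\big)$. DNF denotes disjunctive normal form (set of disjuncts). The algorithm: $etype(E)=etype(E,\emptyset)$; $etype(E,\Psi)=\forall C\in DNF(E).\,etype\_conj(C,\Psi)$; $etype\_conj(C,\Psi)=\mathit{true}$ if $pos(C)\cap neg(C)\neq\emptyset$, $\mathit{true}$ if $\exists C'\in\Psi.\,C\preceq C'$, otherwise $\forall f\in\bigcap_{\alpha\in pos(C)}\mathcal{F}(\alpha).\,eseq(\mathcal{B}^f_C,\Psi\cup\{C\})$; $eseq(\Theta,\Psi)=\forall\Gamma\in DNF(\Theta).\,eseq\_conj(\Gamma,\Psi)$; $eseq\_conj(\Gamma,\Psi)$ is $\mathit{true}$ if $\|\Gamma\|=0$ and $\Lambda\in\Gamma$, $\mathit{false}$ if $\|\Gamma\|=0$ and $\Lambda\notin\Gamma$, and $\exists 1\le j\le\|\Gamma\|.\,etype(\Gamma|_j,\Psi)$ otherwise. *)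

theory Defs
  imports "HOL-Library.FSet"
begin

datatype 'f trm = Fun 'f "'f trm list"

datatype 'c texp =
    Atom 'c "'c texp list"
  | Top
  | Bot
  | Meet "'c texp" "'c texp"
  | Join "'c texp" "'c texp"
  | Compl "'c texp"

text \<open>A type rule \<open>Rule c zs f as\<close> stands for \<open>c(zs) \<rightarrow> f(as)\<close>, where every argument on the
  right-hand side is a parameter or a type constructor applied to parameters.\<close>

datatype ('c, 'v) rarg = Param 'v | Con 'c "'v list"
datatype ('c, 'f, 'v) rule = Rule 'c "'v list" 'f "('c, 'v) rarg list"

fun inst_arg :: "('v \<Rightarrow> 'c texp) \<Rightarrow> ('c, 'v) rarg \<Rightarrow> 'c texp" where
  "inst_arg \<sigma> (Param z) = \<sigma> z"
| "inst_arg \<sigma> (Con d zs) = Atom d (map \<sigma> zs)"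


section \<open>Disjunctive normal form of type expressions\<close>

datatype 'c literal = Pos "'c texp" | Neg "'c texp"

type_synonym 'c conj = "'c literal fset"

definition pos :: "'c conj \<Rightarrow> 'c texp set" where
  "pos C = {\<omega>. Pos \<omega> |\<in>| C}"

definition neg :: "'c conj \<Rightarrow> 'c texp set" where
  "neg C = {\<omega>. Neg \<omega> |\<in>| C}"

text \<open>\<open>C \<preceq> C'\<close> iff \<open>lit C \<supseteq> lit C'\<close>\<close>

definition conj_le :: "'c conj \<Rightarrow> 'c conj \<Rightarrow> bool" (infix "\<preceq>" 50) where
  "C \<preceq> C' \<longleftrightarrow> C' |\<subseteq>| C"

text \<open>\<open>dnf_pos E\<close> and \<open>dnf_neg E\<close> are the sets of disjuncts of \<open>E\<close> and of the complement of \<open>E\<close>.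
  The empty set of disjuncts is the empty union. Since the complement of \<open>\<top>\<close> is \<open>\<bottom>\<close>, the only
  literal arising from \<open>\<top>\<close> and \<open>\<bottom>\<close> is the positive literal \<open>\<top>\<close>.\<close>

fun dnf_pos :: "'c texp \<Rightarrow> 'c conj set" and dnf_neg :: "'c texp \<Rightarrow> 'c conj set" where
  "dnf_pos (Atom c Es) = {{|Pos (Atom c Es)|}}"
| "dnf_pos Top = {{|Pos Top|}}"
| "dnf_pos Bot = {}"
| "dnf_pos (Meet E F) = {C |\<union>| D | C D. C \<in> dnf_pos E \<and> D \<in> dnf_pos F}"
| "dnf_pos (Join E F) = dnf_pos E \<union> dnf_pos F"
| "dnf_pos (Compl E) = dnf_neg E"
| "dnf_neg (Atom c Es) = {{|Neg (Atom c Es)|}}"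
| "dnf_neg Top = {}"
| "dnf_neg Bot = {{|Pos Top|}}"
| "dnf_neg (Meet E F) = dnf_neg E \<union> dnf_neg F"
| "dnf_neg (Join E F) = {C |\<union>| D | C D. C \<in> dnf_neg E \<and> D \<in> dnf_neg F}"
| "dnf_neg (Compl E) = dnf_pos E"

text \<open>Conjunctive type expressions contain a positive literal; \<open>\<top>\<close> is added if there is none.\<close>

definition DNF :: "'c texp \<Rightarrow> 'c conj set" where
  "DNF E = (\<lambda>C. if pos C = {} then finsert (Pos Top) C else C) ` dnf_pos E"


section \<open>Sequence expressions\<close>

text \<open>\<open>Lam\<close> is the special sequence \<open>\<Lambda>\<close>, of length 0 and without elements.\<close>

datatype 'c seq = Seq "'c texp list" | Lam

fun components :: "'c seq \<Rightarrow> 'c texp list" where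
  "components (Seq Es) = Es"
| "components Lam = []"

text \<open>Intersections and unions of sequence expressions are finitary. Complement is not a constructor:
  it is only ever applied in the form \<open>push(\<not>\<theta>)\<close>, which is \<open>push_neg \<theta>\<close> below and is
  complement-free.\<close>

datatype 'c sexp = Basic "'c seq" | SMeet "'c sexp list" | SJoin "'c sexp list"

text \<open>The equations for \<open>Lam\<close> and \<open>SMeet\<close> (de Morgan) only make the function total; the algorithm
  applies \<open>push_neg\<close> to unions of ordinary sequences.\<close>

fun push_neg :: "'c sexp \<Rightarrow> 'c sexp" where
  "push_neg (Basic (Seq Es)) =
     (if Es = [] then Basic Lam
      else SJoin (map (\<lambda>l. Basic (Seq ((replicate (length Es) Top)[l := Compl (Es ! l)])))
                       [0..<length Es]))"
| "push_neg (Basic Lam) = Basic (Seq [])"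
| "push_neg (SJoin \<theta>s) = SMeet (map push_neg \<theta>s)"
| "push_neg (SMeet \<theta>s) = SJoin (map push_neg \<theta>s)"

text \<open>A conjunctive sequence expression \<open>\<gamma>\<^sub>1 \<sqinter> \<dots> \<sqinter> \<gamma>\<^sub>k\<close> is the list of the \<open>\<gamma>\<^sub>i\<close>.\<close>

type_synonym 'c conj_seq = "'c seq list"

fun seq_DNF :: "'c sexp \<Rightarrow> 'c conj_seq set" where
  "seq_DNF (Basic \<gamma>) = {[\<gamma>]}"
| "seq_DNF (SMeet \<theta>s) = concat ` listset (map seq_DNF \<theta>s)"
| "seq_DNF (SJoin \<theta>s) = \<Union> (set (map seq_DNF \<theta>s))"

text \<open>All sequences in a conjunctive sequence expression have the same length, which is thus the
  minimum of their lengths.\<close>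

definition conj_seq_length :: "'c conj_seq \<Rightarrow> nat" where
  "conj_seq_length \<Gamma> = Min ((\<lambda>\<gamma>. length (components \<gamma>)) ` set \<Gamma>)"

fun Meet_list :: "'c texp list \<Rightarrow> 'c texp" where
  "Meet_list [] = Top"
| "Meet_list [E] = E"
| "Meet_list (E # F # Es) = Meet E (Meet_list (F # Es))"

text \<open>\<open>\<Gamma>|\<^sub>j\<close>, with positions counted from 0\<close>

definition proj :: "'c conj_seq \<Rightarrow> nat \<Rightarrow> 'c texp" where
  "proj \<Gamma> j = Meet_list (map (\<lambda>\<gamma>. components \<gamma> ! j) \<Gamma>)"

text \<open>Finitary operations indexed by a finite set use an arbitrary enumeration of that set.\<close>

definition enum :: "'a set \<Rightarrow> 'a list" where
  "enum A = (SOME xs. set xs = A \<and> distinct xs)"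

lemma set_enum: "finite A \<Longrightarrow> set (enum A) = A"
  unfolding enum_def using someI_ex[OF finite_distinct_list[of A]] by blast


section \<open>Type definitions and their meaning\<close>

text \<open>The function symbols are \<open>Sig\<close> and the type constructors \<open>Tc\<close>. These live in different types
  and are thus disjoint.\<close>

locale type_system =
  fixes Sig :: "'f set" and ar :: "'f \<Rightarrow> nat"
    and Tc :: "'c set" and tar :: "'c \<Rightarrow> nat"
    and \<Delta> :: "('c, 'f, 'v) rule set"
  assumes finite_Sig: "finite Sig"
    and constant_Sig: "\<exists>f\<in>Sig. ar f = 0"
    and finite_Tc: "finite Tc"
    and finite_rules: "finite \<Delta>"
    and wf_rules: "Rule c zs f as \<in> \<Delta> \<Longrightarrow>
      c \<in> Tc \<and> length zs = tar c \<and> distinct zs \<and> f \<in> Sig \<and> length as = ar f \<and>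
      (\<forall>a\<in>set as. (\<exists>z\<in>set zs. a = Param z) \<or>
         (\<exists>d ys. a = Con d ys \<and> d \<in> Tc \<and> length ys = tar d \<and> set ys \<subseteq> set zs))"
begin

inductive_set terms :: "'f trm set" where
  "f \<in> Sig \<Longrightarrow> length ts = ar f \<Longrightarrow> (\<And>t. t \<in> set ts \<Longrightarrow> t \<in> terms) \<Longrightarrow> Fun f ts \<in> terms"

inductive_set type_exprs :: "'c texp set" where
  "c \<in> Tc \<Longrightarrow> length Es = tar c \<Longrightarrow> (\<And>E. E \<in> set Es \<Longrightarrow> E \<in> type_exprs) \<Longrightarrow>
     Atom c Es \<in> type_exprs"
| "Top \<in> type_exprs"
| "Bot \<in> type_exprs"
| "E \<in> type_exprs \<Longrightarrow> F \<in> type_exprs \<Longrightarrow> Meet E F \<in> type_exprs"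
| "E \<in> type_exprs \<Longrightarrow> F \<in> type_exprs \<Longrightarrow> Join E F \<in> type_exprs"
| "E \<in> type_exprs \<Longrightarrow> Compl E \<in> type_exprs"

text \<open>A ground rule \<open>\<omega> \<rightarrow> f(E\<^sub>1, \<dots>, E\<^sub>n)\<close> is represented as \<open>(\<omega>, f, [E\<^sub>1, \<dots>, E\<^sub>n])\<close>.\<close>

definition ground :: "('c texp \<times> 'f \<times> 'c texp list) set" where
  "ground =
     {(Atom c (map \<sigma> zs), f, map (inst_arg \<sigma>) as) | c zs f as \<sigma>.
        Rule c zs f as \<in> \<Delta> \<and> (\<forall>z\<in>set zs. \<sigma> z \<in> type_exprs)} \<union>
     {(Top, f, replicate (ar f) Top) | f. f \<in> Sig}"

text \<open>The defining equations of \<open>\<lbrakk>_\<rbrakk>\<close> determine membership of a ground term by recursion on the term;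
  they are restated below as \<open>meaning_simps\<close>.\<close>

function (sequential) has_type :: "'f trm \<Rightarrow> 'c texp \<Rightarrow> bool" where
  "has_type t Top \<longleftrightarrow> t \<in> terms"
| "has_type t Bot \<longleftrightarrow> False"
| "has_type t (Meet E F) \<longleftrightarrow> has_type t E \<and> has_type t F"
| "has_type t (Join E F) \<longleftrightarrow> has_type t E \<or> has_type t F"
| "has_type t (Compl E) \<longleftrightarrow> t \<in> terms \<and> \<not> has_type t E"
| "has_type (Fun f ts) (Atom c Es) \<longleftrightarrow>
     (\<exists>Fs. (Atom c Es, f, Fs) \<in> ground \<and> list_all2 has_type ts Fs)"
  by pat_completeness auto
termination
  by (relation "measure size <*lex*> measure size")
    (auto simp: less_Suc_eq_le dest: size_list_estimation'[OF _ order_refl, where f = size])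

definition meaning :: "'c texp \<Rightarrow> 'f trm set" where
  "meaning E = {t. has_type t E}"

definition Empty :: "'c texp \<Rightarrow> bool" where
  "Empty E \<longleftrightarrow> meaning E = {}"

lemma meaning_simps:
  "meaning Top = terms"
  "meaning Bot = {}"
  "meaning (Meet E F) = meaning E \<inter> meaning F"
  "meaning (Join E F) = meaning E \<union> meaning F"
  "meaning (Compl E) = terms - meaning E"
  "meaning (Atom c Es) =
     (\<Union>(\<omega>, f, Fs) \<in> {r \<in> ground. fst r = Atom c Es}.
        {Fun f ts | ts. list_all2 (\<lambda>t F. t \<in> meaning F) ts Fs})"
proof -
  show "meaning (Atom c Es) =
     (\<Union>(\<omega>, f, Fs) \<in> {r \<in> ground. fst r = Atom c Es}.
        {Fun f ts | ts. list_all2 (\<lambda>t F. t \<in> meaning F) ts Fs})" (is "_ = ?R")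
  proof (rule set_eqI)
    fix t
    show "t \<in> meaning (Atom c Es) \<longleftrightarrow> t \<in> ?R"
      by (cases t) (force simp: meaning_def)
  qed
qed (auto simp: meaning_def)


section \<open>The algorithm\<close>

text \<open>\<open>root_syms \<alpha>\<close> is \<open>\<F>(\<alpha>)\<close> and \<open>arg_seqs f \<alpha>\<close> is \<open>\<A>\<^sup>f\<^sub>\<alpha>\<close>.\<close>

definition root_syms :: "'c texp \<Rightarrow> 'f set" where
  "root_syms \<alpha> = {f. \<exists>Es. (\<alpha>, f, Es) \<in> ground}"

definition arg_seqs :: "'f \<Rightarrow> 'c texp \<Rightarrow> 'c texp list set" where
  "arg_seqs f \<alpha> = {Es. (\<alpha>, f, Es) \<in> ground}"

definition Join_args :: "'f \<Rightarrow> 'c texp \<Rightarrow> 'c sexp" where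
  "Join_args f \<alpha> = SJoin (map (\<lambda>Es. Basic (Seq Es)) (enum (arg_seqs f \<alpha>)))"

text \<open>\<open>\<B>\<^sup>f\<^sub>C\<close>\<close>

definition args_expr :: "'f \<Rightarrow> 'c conj \<Rightarrow> 'c sexp" where
  "args_expr f C =
     SMeet [SMeet (map (Join_args f) (enum (pos C))),
             SMeet (map (\<lambda>\<tau>. push_neg (Join_args f \<tau>)) (enum (neg C)))]"

text \<open>Termination: all type atoms met by a call lie in a finite set determined by its first argument,
  and every call of \<open>etype_conj\<close> that recurs adds to \<open>\<Psi>\<close> a new conjunctive type expression over
  this set.\<close>

fun atoms :: "'c texp \<Rightarrow> 'c texp set" where
  "atoms (Atom c Es) = {Atom c Es}"
| "atoms Top = {Top}"
| "atoms Bot = {}"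
| "atoms (Meet E F) = atoms E \<union> atoms F"
| "atoms (Join E F) = atoms E \<union> atoms F"
| "atoms (Compl E) = atoms E"

fun args :: "'c texp \<Rightarrow> 'c texp set" where
  "args (Atom c Es) = set Es \<union> (\<Union>E\<in>set Es. args E)"
| "args Top = {}"
| "args Bot = {}"
| "args (Meet E F) = args E \<union> args F"
| "args (Join E F) = args E \<union> args F"
| "args (Compl E) = args E"

definition seq_atoms :: "'c seq \<Rightarrow> 'c texp set" where
  "seq_atoms \<gamma> = (\<Union>E\<in>set (components \<gamma>). atoms E)"

fun sexp_atoms :: "'c sexp \<Rightarrow> 'c texp set" where
  "sexp_atoms (Basic \<gamma>) = seq_atoms \<gamma>"
| "sexp_atoms (SMeet \<theta>s) = (\<Union>\<theta>\<in>set \<theta>s. sexp_atoms \<theta>)"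
| "sexp_atoms (SJoin \<theta>s) = (\<Union>\<theta>\<in>set \<theta>s. sexp_atoms \<theta>)"

lemma finite_atoms: "finite (atoms E)"
  by (induction E rule: atoms.induct) auto

lemma finite_args: "finite (args E)"
  by (induction E rule: args.induct) auto

lemma finite_sexp_atoms: "finite (sexp_atoms \<theta>)"
  by (induction \<theta> rule: sexp_atoms.induct) (auto simp: seq_atoms_def finite_atoms)

lemma args_trans: "E \<in> args F \<Longrightarrow> args E \<subseteq> args F"
  by (induction F rule: args.induct) auto

lemma args_atoms: "a \<in> atoms E \<Longrightarrow> args a \<subseteq> args E"
  by (induction E rule: atoms.induct) auto

lemma finite_pos_neg: "finite (pos C)" "finite (neg C)"
proof -
  have "pos C = Pos -` fset C" "neg C = Neg -` fset C"
    by (auto simp: pos_def neg_def)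
  then show "finite (pos C)" "finite (neg C)"
    by (auto intro!: finite_vimageI simp: inj_def)
qed

lemma pos_neg_simps:
  "pos {||} = {}" "neg {||} = {}"
  "pos {|Pos a|} = {a}" "neg {|Pos a|} = {}" "pos {|Neg a|} = {}" "neg {|Neg a|} = {a}"
  "pos (C |\<union>| D) = pos C \<union> pos D" "neg (C |\<union>| D) = neg C \<union> neg D"
  "pos (finsert (Pos a) C) = insert a (pos C)" "neg (finsert (Pos a) C) = neg C"
  by (auto simp: pos_def neg_def)

lemma dnf_atoms:
  "C \<in> dnf_pos E \<Longrightarrow> pos C \<union> neg C \<subseteq> insert Top (atoms E)"
  "C \<in> dnf_neg E \<Longrightarrow> pos C \<union> neg C \<subseteq> insert Top (atoms E)"
proof -
  define ok :: "'c texp set \<Rightarrow> 'c conj \<Rightarrow> bool"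
    where "ok X C \<longleftrightarrow> pos C \<union> neg C \<subseteq> insert Top X" for X C
  have [intro]: "ok (X \<union> Y) C" if "ok X C \<or> ok Y C" for X Y C
    using that by (auto simp: ok_def)
  have [intro]: "ok (X \<union> Y) (C |\<union>| D)" if "ok X C" "ok Y D" for X Y C D
    using that by (auto simp: ok_def pos_neg_simps)
  have "(\<forall>C\<in>dnf_pos E. ok (atoms E) C) \<and> (\<forall>C\<in>dnf_neg E. ok (atoms E) C)"
  proof (induction E)
    case (Meet E F)
    then show ?case by auto
  next
    case (Join E F)
    then show ?case by auto
  qed (simp_all add: ok_def pos_neg_simps)
  then show "C \<in> dnf_pos E \<Longrightarrow> pos C \<union> neg C \<subseteq> insert Top (atoms E)"
    "C \<in> dnf_neg E \<Longrightarrow> pos C \<union> neg C \<subseteq> insert Top (atoms E)"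
    unfolding ok_def by blast+
qed

lemma DNF_atoms: "C \<in> DNF E \<Longrightarrow> pos C \<union> neg C \<subseteq> insert Top (atoms E)"
  using dnf_atoms(1) by (fastforce simp: DNF_def pos_neg_simps)

lemma sexp_atoms_push_neg: "sexp_atoms (push_neg \<theta>) \<subseteq> insert Top (sexp_atoms \<theta>)"
proof (induction \<theta> rule: push_neg.induct)
  case (1 Es)
  have "atoms E \<subseteq> insert Top (\<Union>E\<in>set Es. atoms E)"
    if "E \<in> set ((replicate (length Es) Top)[l := Compl (Es ! l)])" "l < length Es" for l E
    using that set_update_subset_insert[of "replicate (length Es) Top" l "Compl (Es ! l)"]
    by (cases "E = Compl (Es ! l)") (auto split: if_splits)
  then show ?case
    by (auto simp: seq_atoms_def split: if_splits) blast
qed (fastforce simp: seq_atoms_def)+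

lemma listset_iff: "xs \<in> listset As \<longleftrightarrow> list_all2 (\<in>) xs As"
  by (induction As arbitrary: xs) (auto simp: set_Cons_def list_all2_Cons2)

lemma seq_DNF_atoms: "\<Gamma> \<in> seq_DNF \<theta> \<Longrightarrow> \<gamma> \<in> set \<Gamma> \<Longrightarrow> seq_atoms \<gamma> \<subseteq> sexp_atoms \<theta>"
proof (induction \<theta> arbitrary: \<Gamma> rule: seq_DNF.induct)
  case (2 \<theta>s)
  then obtain \<Gamma>s where \<Gamma>s: "list_all2 (\<in>) \<Gamma>s (map seq_DNF \<theta>s)" "\<Gamma> = concat \<Gamma>s"
    by (auto simp: listset_iff)
  with 2(3) obtain i where "i < length \<Gamma>s" "\<gamma> \<in> set (\<Gamma>s ! i)"
    by (auto simp: in_set_conv_nth[of _ \<Gamma>s])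
  with \<Gamma>s 2(1)[of "\<theta>s ! i" "\<Gamma>s ! i"] show ?case
    by (fastforce simp: list_all2_conv_all_nth)
qed auto

lemma Meet_list_atoms: "atoms (Meet_list Es) \<subseteq> insert Top (\<Union>E\<in>set Es. atoms E)"
  by (induction Es rule: Meet_list.induct) auto

lemma proj_atoms:
  assumes "j < conj_seq_length \<Gamma>"
  shows "atoms (proj \<Gamma> j) \<subseteq> insert Top (\<Union>\<gamma>\<in>set \<Gamma>. seq_atoms \<gamma>)"
proof -
  have "j < length (components \<gamma>)" if "\<gamma> \<in> set \<Gamma>" for \<gamma>
  proof -
    have "conj_seq_length \<Gamma> \<le> length (components \<gamma>)"
      unfolding conj_seq_length_def using that by (intro Min_le) auto
    with assms show ?thesis by simp
  qed
  then show ?thesis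
    using Meet_list_atoms[of "map (\<lambda>\<gamma>. components \<gamma> ! j) \<Gamma>"]
    by (fastforce simp: proj_def seq_atoms_def)
qed

definition reach :: "'c texp set \<Rightarrow> 'c texp set" where
  "reach A = insert Top (A \<union> (\<Union>E\<in>\<Union>(args ` A). atoms E) \<union>
     {Atom d Es | d Es. d \<in> Tc \<and> length Es = tar d \<and> set Es \<subseteq> \<Union>(args ` A)})"

lemma finite_reach: "finite A \<Longrightarrow> finite (reach A)"
proof -
  assume A: "finite A"
  let ?P = "\<Union>(args ` A)"
  have P: "finite ?P" using A by (auto simp: finite_args)
  have "{Atom d Es | d Es. d \<in> Tc \<and> length Es = tar d \<and> set Es \<subseteq> ?P} =
      (\<Union>d\<in>Tc. Atom d ` {Es. set Es \<subseteq> ?P \<and> length Es = tar d})"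
    by auto
  also have "finite \<dots>"
    by (intro finite_UN_I finite_imageI finite_lists_length_eq finite_Tc P)
  finally show ?thesis
    using A P by (auto simp: reach_def finite_atoms)
qed

lemma args_reach:
  assumes "a \<in> reach A"
  shows "args a \<subseteq> \<Union>(args ` A)"
proof -
  from assms consider "a = Top" | "a \<in> A" | E F where "F \<in> A" "E \<in> args F" "a \<in> atoms E"
    | d Es where "a = Atom d Es" "set Es \<subseteq> \<Union>(args ` A)"
    unfolding reach_def by blast
  then show ?thesis
  proof cases
    case 3
    have "args a \<subseteq> args E" using 3(3) by (rule args_atoms)
    also have "\<dots> \<subseteq> args F" using 3(2) by (rule args_trans)
    also have "\<dots> \<subseteq> \<Union>(args ` A)" using 3(1) by (rule UN_upper)
    finally show ?thesis .
  next
    case 4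
    have "args E \<subseteq> \<Union>(args ` A)" if E: "E \<in> set Es" for E
    proof -
      from E 4(2) obtain F where F: "F \<in> A" "E \<in> args F" by blast
      have "args E \<subseteq> args F" using F(2) by (rule args_trans)
      also have "\<dots> \<subseteq> \<Union>(args ` A)" using F(1) by (rule UN_upper)
      finally show ?thesis .
    qed
    then have "(\<Union>E\<in>set Es. args E) \<subseteq> \<Union>(args ` A)" by (rule UN_least)
    with 4 show ?thesis by simp
  next
    case 2
    then show ?thesis by (rule UN_upper)
  qed simp
qed

lemma reach_closed:
  assumes "B \<subseteq> reach A"
  shows "reach B \<subseteq> reach A"
proof
  have *: "\<Union>(args ` B) \<subseteq> \<Union>(args ` A)"
    using args_reach assms by blast
  fix a assume "a \<in> reach B"
  then consider "a = Top" | "a \<in> B" | E where "E \<in> \<Union>(args ` B)" "a \<in> atoms E"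
    | d Es where "a = Atom d Es" "d \<in> Tc" "length Es = tar d" "set Es \<subseteq> \<Union>(args ` B)"
    unfolding reach_def by blast
  then show "a \<in> reach A"
  proof cases
    case 1
    then show ?thesis by (simp add: reach_def)
  next
    case 2
    with assms show ?thesis by blast
  next
    case 3
    with * have "E \<in> \<Union>(args ` A)" by blast
    with 3 show ?thesis unfolding reach_def by blast
  next
    case 4
    from 4(4) * have "set Es \<subseteq> \<Union>(args ` A)" by (rule subset_trans)
    with 4 show ?thesis unfolding reach_def by blast
  qed
qed

lemma ground_reach:
  assumes "(\<omega>, f, Es) \<in> ground" "\<omega> \<in> reach A" "E \<in> set Es"
  shows "atoms E \<subseteq> reach A"
proof (cases "\<omega> = Top")
  case True
  with assms show ?thesis by (auto simp: ground_def reach_def)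
next
  case False
  with assms(1) obtain c zs as \<sigma> where r: "Rule c zs f as \<in> \<Delta>"
    "\<omega> = Atom c (map \<sigma> zs)" "Es = map (inst_arg \<sigma>) as"
    by (auto simp: ground_def)
  have P: "\<sigma> ` set zs \<subseteq> \<Union>(args ` A)"
    using args_reach[OF assms(2)] r(2) by auto
  from assms(3) r(3) obtain a where a: "a \<in> set as" "E = inst_arg \<sigma> a" by auto
  with wf_rules[OF r(1)]
  consider z where "z \<in> set zs" "a = Param z"
    | d ys where "a = Con d ys" "d \<in> Tc" "length ys = tar d" "set ys \<subseteq> set zs"
    by blast
  then show ?thesis
  proof cases
    case 1
    with P a show ?thesis by (auto simp: reach_def)
  next
    case 2
    then have "set (map \<sigma> ys) \<subseteq> \<Union>(args ` A)" using P by auto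
    with 2 a show ?thesis by (auto simp: reach_def)
  qed
qed

lemma finite_arg_seqs: "finite (arg_seqs f \<alpha>)"
proof -
  define h where "h r = (case r of Rule c zs g as \<Rightarrow>
    map (inst_arg (SOME \<sigma>. \<alpha> = Atom c (map \<sigma> zs))) as)" for r :: "('c, 'f, 'v) rule"
  have "arg_seqs f \<alpha> \<subseteq> insert (replicate (ar f) Top) (h ` \<Delta>)"
  proof
    fix Es assume "Es \<in> arg_seqs f \<alpha>"
    then consider "Es = replicate (ar f) Top"
      | c zs as \<sigma> where "Rule c zs f as \<in> \<Delta>" "\<alpha> = Atom c (map \<sigma> zs)" "Es = map (inst_arg \<sigma>) as"
      by (auto simp: arg_seqs_def ground_def)
    then show "Es \<in> insert (replicate (ar f) Top) (h ` \<Delta>)"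
    proof cases
      case 2
      define \<sigma>' where "\<sigma>' = (SOME \<sigma>. \<alpha> = Atom c (map \<sigma> zs))"
      have "\<alpha> = Atom c (map \<sigma>' zs)"
        unfolding \<sigma>'_def by (rule someI[of "\<lambda>\<sigma>. \<alpha> = Atom c (map \<sigma> zs)"]) (rule 2(2))
      then have eq: "\<sigma>' z = \<sigma> z" if "z \<in> set zs" for z
        using 2(2) that by auto
      have "inst_arg \<sigma>' a = inst_arg \<sigma> a" if "a \<in> set as" for a
      proof -
        from wf_rules[OF 2(1)] that
        consider z where "z \<in> set zs" "a = Param z"
          | d ys where "a = Con d ys" "set ys \<subseteq> set zs"
          by blast
        then show ?thesis by cases (auto simp: eq)
      qed
      then have "Es = h (Rule c zs f as)"
        using 2(3) by (simp add: h_def flip: \<sigma>'_def)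
      with 2(1) show ?thesis by blast
    qed simp
  qed
  then show ?thesis
    using finite_rules by (auto intro: finite_subset)
qed

lemma args_expr_atoms: "sexp_atoms (args_expr f C) \<subseteq> reach (pos C \<union> neg C)"
proof -
  let ?R = "reach (pos C \<union> neg C)"
  have "Top \<in> ?R" by (simp add: reach_def)
  moreover have J: "sexp_atoms (Join_args f \<omega>) \<subseteq> ?R" if "\<omega> \<in> pos C \<union> neg C" for \<omega>
  proof -
    have "\<omega> \<in> ?R" using that by (auto simp: reach_def)
    then have "atoms E \<subseteq> ?R" if "Es \<in> arg_seqs f \<omega>" "E \<in> set Es" for Es E
      using that ground_reach by (auto simp: arg_seqs_def)
    then show ?thesis
      by (auto simp: Join_args_def set_enum[OF finite_arg_seqs] seq_atoms_def)
  qed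
  moreover have "sexp_atoms (push_neg (Join_args f \<omega>)) \<subseteq> ?R" if "\<omega> \<in> neg C" for \<omega>
    using J[of \<omega>] that sexp_atoms_push_neg[of "Join_args f \<omega>"] \<open>Top \<in> ?R\<close> by auto
  ultimately show ?thesis
    by (auto simp: args_expr_def set_enum finite_pos_neg)
qed

definition weight :: "'c texp set \<Rightarrow> 'c conj set \<Rightarrow> nat" where
  "weight A \<Psi> = card ({C. pos C \<union> neg C \<subseteq> reach A} - \<Psi>)"

lemma finite_conjs:
  assumes "finite A"
  shows "finite {C. pos C \<union> neg C \<subseteq> reach A}"
proof (rule finite_imageD)
  have "fset ` {C. pos C \<union> neg C \<subseteq> reach A} \<subseteq> Pow (Pos ` reach A \<union> Neg ` reach A)"
  proof (intro image_subsetI PowI subsetI)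
    fix C l assume "C \<in> {C. pos C \<union> neg C \<subseteq> reach A}" "l \<in> fset C"
    then show "l \<in> Pos ` reach A \<union> Neg ` reach A"
      by (cases l) (auto simp: pos_def neg_def)
  qed
  then show "finite (fset ` {C. pos C \<union> neg C \<subseteq> reach A})"
    using finite_reach[OF assms] by (auto intro: finite_subset)
qed (auto simp: inj_on_def fset_inject)

lemma weight_mono: "finite A \<Longrightarrow> B \<subseteq> reach A \<Longrightarrow> weight B \<Psi> \<le> weight A \<Psi>"
  unfolding weight_def using reach_closed[of B A] finite_conjs[of A]
  by (intro card_mono) auto

lemma weight_less:
  assumes "B \<subseteq> reach (pos C \<union> neg C)" "C \<notin> \<Psi>"
  shows "weight B (\<Psi> \<union> {C}) < weight (pos C \<union> neg C) \<Psi>"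
proof -
  have "pos C \<union> neg C \<subseteq> reach (pos C \<union> neg C)" by (auto simp: reach_def)
  then show ?thesis
    unfolding weight_def using reach_closed[OF assms(1)] assms(2)
    by (intro psubset_card_mono finite_Diff finite_conjs) (auto simp: finite_pos_neg)
qed

text \<open>The initial call \<open>etype(E)\<close> is \<open>etype E {}\<close>.\<close>

function etype :: "'c texp \<Rightarrow> 'c conj set \<Rightarrow> bool"
  and etype_conj :: "'c conj \<Rightarrow> 'c conj set \<Rightarrow> bool"
  and eseq :: "'c sexp \<Rightarrow> 'c conj set \<Rightarrow> bool"
  and eseq_conj :: "'c conj_seq \<Rightarrow> 'c conj set \<Rightarrow> bool" where
  "etype E \<Psi> = (\<forall>C\<in>DNF E. etype_conj C \<Psi>)"
| "etype_conj C \<Psi> =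
     (if pos C \<inter> neg C \<noteq> {} then True
      else if \<exists>C'\<in>\<Psi>. C \<preceq> C' then True
      else \<forall>f\<in>(\<Inter>\<alpha>\<in>pos C. root_syms \<alpha>). eseq (args_expr f C) (\<Psi> \<union> {C}))"
| "eseq \<Theta> \<Psi> = (\<forall>\<Gamma>\<in>seq_DNF \<Theta>. eseq_conj \<Gamma> \<Psi>)"
| "eseq_conj \<Gamma> \<Psi> =
     (if conj_seq_length \<Gamma> = 0 \<and> Lam \<in> set \<Gamma> then True
      else if conj_seq_length \<Gamma> = 0 \<and> Lam \<notin> set \<Gamma> then False
      else \<exists>j\<in>{..<conj_seq_length \<Gamma>}. etype (proj \<Gamma> j) \<Psi>)"
  by pat_completeness auto

termination
proof (relation "measures
    [case_sum
       (case_sum (\<lambda>(E, \<Psi>). weight (atoms E) \<Psi>) (\<lambda>(C, \<Psi>). weight (pos C \<union> neg C) \<Psi>))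
       (case_sum (\<lambda>(\<Theta>, \<Psi>). weight (sexp_atoms \<Theta>) \<Psi>)
                 (\<lambda>(\<Gamma>, \<Psi>). weight (\<Union>\<gamma>\<in>set \<Gamma>. seq_atoms \<gamma>) \<Psi>)),
     case_sum (case_sum (\<lambda>_. 1) (\<lambda>_. 0)) (case_sum (\<lambda>_. 3) (\<lambda>_. 2))]", goal_cases)
  case 1
  show ?case by simp
next
  case (2 E \<Psi> C)
  have "insert Top (atoms E) \<subseteq> reach (atoms E)" by (auto simp: reach_def)
  with DNF_atoms[OF 2] have "weight (pos C \<union> neg C) \<Psi> \<le> weight (atoms E) \<Psi>"
    by (intro weight_mono finite_atoms) auto
  then show ?case by auto
next
  case (3 C \<Psi> f)
  then have "C \<notin> \<Psi>" by (auto simp: conj_le_def)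
  from weight_less[OF args_expr_atoms this] show ?case by simp
next
  case (4 \<Theta> \<Psi> \<Gamma>)
  have "(\<Union>\<gamma>\<in>set \<Gamma>. seq_atoms \<gamma>) \<subseteq> reach (sexp_atoms \<Theta>)"
    using seq_DNF_atoms[OF 4] by (fastforce simp: reach_def)
  from weight_mono[OF finite_sexp_atoms this] show ?case by (auto simp: le_less)
next
  case (5 \<Gamma> \<Psi> j)
  let ?A = "\<Union>\<gamma>\<in>set \<Gamma>. seq_atoms \<gamma>"
  have "finite ?A" by (auto simp: seq_atoms_def finite_atoms)
  moreover have "atoms (proj \<Gamma> j) \<subseteq> reach ?A"
    using proj_atoms[of j \<Gamma>] 5 by (auto simp: reach_def)
  ultimately have "weight (atoms (proj \<Gamma> j)) \<Psi> \<le> weight ?A \<Psi>" by (rule weight_mono)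
  then show ?case by (auto simp: le_less)
qed

declare etype.simps [simp del] etype_conj.simps [simp del]
  eseq.simps [simp del] eseq_conj.simps [simp del]

end

end

theory Submission
  imports Defs
begin

text \<open>Soundness: the disjuncts in \<open>\<Psi>\<close> act as coinductive hypotheses. If a call on \<open>C\<close> and \<open>\<Psi>\<close> returns
  true although \<open>C\<close> has an element \<open>t\<close>, then some member of \<open>\<Psi>\<close> has an element that is not larger than
  \<open>t\<close>; when \<open>C\<close> itself is added to \<open>\<Psi>\<close>, this is applied to a subterm of an element of \<open>C\<close> of minimal size,
  so that the smaller element cannot belong to \<open>C\<close>. For \<open>\<Psi> = {}\<close> there is no such member.
  Completeness: a failing call yields an element, built bottom-up along the recursion.\<close>

context type_system
begin

section \<open>Ground terms and the typing of atoms\<close>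

lemma has_type_terms: "has_type t E \<Longrightarrow> t \<in> terms"
proof (induction t E rule: has_type.induct)
  case (6 f ts c Es)
  from "6.prems" obtain Fs where Fs: "(Atom c Es, f, Fs) \<in> ground" "list_all2 has_type ts Fs"
    by auto
  from Fs(1) obtain zs as \<sigma> where "Rule c zs f as \<in> \<Delta>" "Fs = map (inst_arg \<sigma>) as"
    by (auto simp: ground_def)
  with wf_rules have "f \<in> Sig" "length Fs = ar f" by auto
  moreover have "t \<in> terms" if t: "t \<in> set ts" for t
  proof -
    from t Fs(2) obtain F where "F \<in> set Fs" "has_type t F"
      by (metis in_set_conv_nth list_all2_conv_all_nth)
    with "6.IH" t show ?thesis by blast
  qed
  ultimately show ?case
    using Fs(2) by (auto intro!: terms.intros dest: list_all2_lengthD)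
qed auto

lemma ground_Sig: "(\<omega>, f, Es) \<in> ground \<Longrightarrow> f \<in> Sig \<and> length Es = ar f"
  using wf_rules by (auto simp: ground_def)

lemma Fun_terms_iff: "Fun f ts \<in> terms \<longleftrightarrow> f \<in> Sig \<and> length ts = ar f \<and> set ts \<subseteq> terms"
  by (auto elim: terms.cases intro: terms.intros)

text \<open>\<open>Top\<close> counts as atomic because \<open>ground\<close> contains rules for it,
  so the positive literal \<open>Top\<close> can be treated like any other atom.\<close>

definition is_atomic :: "'c texp \<Rightarrow> bool" where
  "is_atomic \<omega> \<longleftrightarrow> \<omega> = Top \<or> (\<exists>c Es. \<omega> = Atom c Es)"

lemma atoms_atomic: "\<omega> \<in> atoms E \<Longrightarrow> is_atomic \<omega>"
  by (induction E rule: atoms.induct) (auto simp: is_atomic_def)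

text \<open>For a type constructor this is the recursion equation of \<open>has_type\<close>; for
  \<open>Top\<close> the only argument sequence consists of \<open>Top\<close>s, which restates the
  formation rule of \<open>terms\<close>.\<close>

lemma has_type_atomic:
  assumes "is_atomic \<omega>"
  shows "has_type (Fun f ts) \<omega> \<longleftrightarrow> (\<exists>Es\<in>arg_seqs f \<omega>. list_all2 has_type ts Es)"
proof (cases "\<omega> = Top")
  case True
  have "arg_seqs f Top = (if f \<in> Sig then {replicate (ar f) Top} else {})"
    by (auto simp: arg_seqs_def ground_def)
  with True show ?thesis
    by (auto simp: Fun_terms_iff list_all2_conv_all_nth in_set_conv_nth subset_iff)
next
  case False
  with assms show ?thesis by (auto simp: is_atomic_def arg_seqs_def)
qed


section \<open>Conjunctive type expressions and their disjunctive normal form\<close>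

definition conj_mem :: "'f trm \<Rightarrow> 'c conj \<Rightarrow> bool" where
  "conj_mem t C \<longleftrightarrow> t \<in> terms \<and> (\<forall>\<omega>\<in>pos C. has_type t \<omega>) \<and> (\<forall>\<tau>\<in>neg C. \<not> has_type t \<tau>)"

lemma conj_mem_union: "conj_mem t (C |\<union>| D) \<longleftrightarrow> conj_mem t C \<and> conj_mem t D"
  by (auto simp: conj_mem_def pos_neg_simps)

lemma conj_mem_le: "C \<preceq> C' \<Longrightarrow> conj_mem t C \<Longrightarrow> conj_mem t C'"
  by (auto simp: conj_mem_def conj_le_def pos_def neg_def)

text \<open>Both equivalences go through one induction because \<open>Compl\<close> exchanges
  \<open>dnf_pos\<close> and \<open>dnf_neg\<close>.\<close>

lemma dnf_mem:
  assumes "t \<in> terms"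
  shows "(\<exists>C\<in>dnf_pos E. conj_mem t C) \<longleftrightarrow> has_type t E"
    and "(\<exists>C\<in>dnf_neg E. conj_mem t C) \<longleftrightarrow> \<not> has_type t E"
proof -
  have "((\<exists>C\<in>dnf_pos E. conj_mem t C) \<longleftrightarrow> has_type t E) \<and>
    ((\<exists>C\<in>dnf_neg E. conj_mem t C) \<longleftrightarrow> \<not> has_type t E)"
  proof (induction E)
    case (Meet E F)
    have "(\<exists>C\<in>dnf_pos (Meet E F). conj_mem t C) \<longleftrightarrow>
        (\<exists>C\<in>dnf_pos E. conj_mem t C) \<and> (\<exists>C\<in>dnf_pos F. conj_mem t C)"
      by (auto simp: conj_mem_union) (metis conj_mem_union)
    with Meet show ?case by (simp add: bex_Un)
  next
    case (Join E F)
    have "(\<exists>C\<in>dnf_neg (Join E F). conj_mem t C) \<longleftrightarrow>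
        (\<exists>C\<in>dnf_neg E. conj_mem t C) \<and> (\<exists>C\<in>dnf_neg F. conj_mem t C)"
      by (auto simp: conj_mem_union) (metis conj_mem_union)
    with Join show ?case by (simp add: bex_Un)
  qed (use assms in \<open>auto simp: conj_mem_def pos_neg_simps\<close>)
  then show "(\<exists>C\<in>dnf_pos E. conj_mem t C) \<longleftrightarrow> has_type t E"
    "(\<exists>C\<in>dnf_neg E. conj_mem t C) \<longleftrightarrow> \<not> has_type t E"
    by blast+
qed

text \<open>Adding the literal \<open>Top\<close> changes no members, since \<open>conj_mem\<close>
  already demands a ground term.\<close>

lemma DNF_mem: "(\<exists>C\<in>DNF E. conj_mem t C) \<longleftrightarrow> has_type t E"
proof -
  have "conj_mem t (if pos C = {} then finsert (Pos Top) C else C) \<longleftrightarrow> conj_mem t C" for C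
    by (auto simp: conj_mem_def pos_neg_simps)
  then have "(\<exists>C\<in>DNF E. conj_mem t C) \<longleftrightarrow> (\<exists>C\<in>dnf_pos E. conj_mem t C)"
    unfolding DNF_def by blast
  also have "\<dots> \<longleftrightarrow> has_type t E"
    using dnf_mem(1)[of t E] has_type_terms[of t E] by (auto simp: conj_mem_def)
  finally show ?thesis .
qed

text \<open>The invariant of \<open>etype_conj\<close>. A positive literal keeps the intersection of
  the \<open>root_syms\<close> inside \<open>Sig\<close> and makes every disjunct of
  \<open>args_expr\<close> a non-empty list.\<close>

definition wf_conj :: "'c conj \<Rightarrow> bool" where
  "wf_conj C \<longleftrightarrow> pos C \<noteq> {} \<and> (\<forall>\<omega>\<in>pos C \<union> neg C. is_atomic \<omega>)"

lemma DNF_wf: "C \<in> DNF E \<Longrightarrow> wf_conj C"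
proof -
  assume C: "C \<in> DNF E"
  then have "pos C \<noteq> {}" by (auto simp: DNF_def pos_neg_simps)
  moreover have "is_atomic \<omega>" if "\<omega> \<in> pos C \<union> neg C" for \<omega>
    using DNF_atoms[OF C] that atoms_atomic[of \<omega> E] by (auto simp: is_atomic_def)
  ultimately show ?thesis by (simp add: wf_conj_def)
qed


section \<open>Sequence expressions as sets of term tuples\<close>

fun seq_mem :: "'f trm list \<Rightarrow> 'c seq \<Rightarrow> bool" where
  "seq_mem ts (Seq Es) \<longleftrightarrow> list_all2 has_type ts Es"
| "seq_mem ts Lam \<longleftrightarrow> False"

fun sexp_mem :: "'f trm list \<Rightarrow> 'c sexp \<Rightarrow> bool" where
  "sexp_mem ts (Basic \<gamma>) \<longleftrightarrow> seq_mem ts \<gamma>"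
| "sexp_mem ts (SMeet \<theta>s) \<longleftrightarrow> (\<forall>\<theta>\<in>set \<theta>s. sexp_mem ts \<theta>)"
| "sexp_mem ts (SJoin \<theta>s) \<longleftrightarrow> (\<exists>\<theta>\<in>set \<theta>s. sexp_mem ts \<theta>)"

fun sexp_arity :: "nat \<Rightarrow> 'c sexp \<Rightarrow> bool" where
  "sexp_arity n (Basic \<gamma>) \<longleftrightarrow> length (components \<gamma>) = n"
| "sexp_arity n (SMeet \<theta>s) \<longleftrightarrow> (\<forall>\<theta>\<in>set \<theta>s. sexp_arity n \<theta>)"
| "sexp_arity n (SJoin \<theta>s) \<longleftrightarrow> (\<forall>\<theta>\<in>set \<theta>s. sexp_arity n \<theta>)"

text \<open>Choosing a list amounts to choosing its entries independently; this distributes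
  intersection over union in \<open>seq_DNF\<close>.\<close>

lemma ex_list_all2_iff:
  "(\<exists>xs. list_all2 R xs ys \<and> (\<forall>x\<in>set xs. P x)) \<longleftrightarrow> (\<forall>y\<in>set ys. \<exists>x. R x y \<and> P x)"
proof (induction ys)
  case (Cons y ys)
  have "(\<exists>xs. list_all2 R xs (y # ys) \<and> (\<forall>x\<in>set xs. P x)) \<longleftrightarrow>
      (\<exists>x. R x y \<and> P x) \<and> (\<exists>xs. list_all2 R xs ys \<and> (\<forall>x\<in>set xs. P x))"
    by (auto simp: list_all2_Cons2) (metis list.set_intros set_ConsD)
  with Cons show ?case by simp
qed simp

lemma seq_DNF_mem: "(\<exists>\<Gamma>\<in>seq_DNF \<theta>. \<forall>\<gamma>\<in>set \<Gamma>. seq_mem ts \<gamma>) \<longleftrightarrow> sexp_mem ts \<theta>"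
proof (induction \<theta> rule: seq_DNF.induct)
  case (2 \<theta>s)
  have "(\<exists>\<Gamma>\<in>seq_DNF (SMeet \<theta>s). \<forall>\<gamma>\<in>set \<Gamma>. seq_mem ts \<gamma>) \<longleftrightarrow>
      (\<exists>\<Gamma>s. list_all2 (\<in>) \<Gamma>s (map seq_DNF \<theta>s) \<and> (\<forall>\<Gamma>\<in>set \<Gamma>s. \<forall>\<gamma>\<in>set \<Gamma>. seq_mem ts \<gamma>))"
    by (fastforce simp: listset_iff)
  also have "\<dots> \<longleftrightarrow> (\<forall>\<theta>\<in>set \<theta>s. \<exists>\<Gamma>\<in>seq_DNF \<theta>. \<forall>\<gamma>\<in>set \<Gamma>. seq_mem ts \<gamma>)"
    by (subst ex_list_all2_iff) auto
  finally show ?case using 2 by simp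
qed auto

lemma seq_DNF_arity:
  "sexp_arity n \<theta> \<Longrightarrow> \<Gamma> \<in> seq_DNF \<theta> \<Longrightarrow> \<gamma> \<in> set \<Gamma> \<Longrightarrow> length (components \<gamma>) = n"
proof (induction \<theta> arbitrary: \<Gamma> rule: seq_DNF.induct)
  case (2 \<theta>s)
  then obtain \<Gamma>s where \<Gamma>s: "list_all2 (\<in>) \<Gamma>s (map seq_DNF \<theta>s)" "\<Gamma> = concat \<Gamma>s"
    by (auto simp: listset_iff)
  with "2.prems"(3) obtain i where "i < length \<Gamma>s" "\<gamma> \<in> set (\<Gamma>s ! i)"
    by (auto simp: in_set_conv_nth[of _ \<Gamma>s])
  with \<Gamma>s "2.prems"(1) "2.IH"[of "\<theta>s ! i" "\<Gamma>s ! i"] show ?case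
    by (auto simp: list_all2_conv_all_nth)
qed auto

lemma push_neg_arity: "sexp_arity n \<theta> \<Longrightarrow> sexp_arity n (push_neg \<theta>)"
  by (induction \<theta> rule: push_neg.induct) auto

text \<open>A tuple of the right length lies outside a product iff some entry lies outside its
  factor; the other entries satisfy \<open>Top\<close> because they are ground terms. At length 0
  the only tuple is \<open>[]\<close>, so \<open>Seq []\<close> and \<open>Lam\<close> are
  complements of each other.\<close>

lemma push_neg_mem:
  "sexp_arity (length ts) \<theta> \<Longrightarrow> set ts \<subseteq> terms \<Longrightarrow> sexp_mem ts (push_neg \<theta>) \<longleftrightarrow> \<not> sexp_mem ts \<theta>"
proof (induction \<theta> rule: push_neg.induct)
  case (1 Es)
  have "list_all2 has_type ts ((replicate (length Es) Top)[l := Compl (Es ! l)]) \<longleftrightarrow>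
      \<not> has_type (ts ! l) (Es ! l)" if "l < length Es" for l
    using that 1 by (auto simp: list_all2_conv_all_nth nth_list_update subset_iff)
  with 1 show ?case by (auto simp: list_all2_conv_all_nth)
qed auto

lemma Join_args_arity: "sexp_arity (ar f) (Join_args f \<omega>)"
proof -
  have "length Es = ar f" if "Es \<in> arg_seqs f \<omega>" for Es
    using that ground_Sig by (auto simp: arg_seqs_def)
  then show ?thesis by (simp add: Join_args_def set_enum[OF finite_arg_seqs])
qed

lemma args_expr_arity: "sexp_arity (ar f) (args_expr f C)"
  by (auto simp: args_expr_def Join_args_arity push_neg_arity)

lemma Join_args_mem: "is_atomic \<omega> \<Longrightarrow> sexp_mem ts (Join_args f \<omega>) \<longleftrightarrow> has_type (Fun f ts) \<omega>"
  by (simp add: Join_args_def set_enum[OF finite_arg_seqs] has_type_atomic)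

text \<open>This links the two levels: \<open>args_expr f C\<close> describes exactly the argument
  tuples of the elements of \<open>C\<close> with root \<open>f\<close>.\<close>

lemma args_expr_mem:
  assumes "wf_conj C" "Fun f ts \<in> terms"
  shows "sexp_mem ts (args_expr f C) \<longleftrightarrow> conj_mem (Fun f ts) C"
proof -
  have "sexp_mem ts (push_neg (Join_args f \<tau>)) \<longleftrightarrow> \<not> has_type (Fun f ts) \<tau>" if "\<tau> \<in> neg C" for \<tau>
    using that assms Join_args_arity[of f \<tau>]
    by (simp add: push_neg_mem Join_args_mem Fun_terms_iff wf_conj_def)
  with assms show ?thesis
    by (auto simp: args_expr_def set_enum finite_pos_neg conj_mem_def Join_args_mem wf_conj_def)
qed

text \<open>Each disjunct concatenates one choice per literal, and a positive literal contributes a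
  one-element list.\<close>

lemma args_expr_DNF_nonempty:
  assumes "pos C \<noteq> {}" "\<Gamma> \<in> seq_DNF (args_expr f C)"
  shows "\<Gamma> \<noteq> []"
proof -
  have ne: "\<Gamma>' \<noteq> []" if "\<Gamma>' \<in> seq_DNF (Join_args f \<omega>)" for \<Gamma>' \<omega>
    using that by (auto simp: Join_args_def)
  from assms(1) have "enum (pos C) \<noteq> []"
    using set_enum[of "pos C"] finite_pos_neg(1)[of C] by auto
  then obtain \<omega> \<omega>s where "enum (pos C) = \<omega> # \<omega>s" by (cases "enum (pos C)") auto
  with assms(2) show ?thesis
    by (auto simp: args_expr_def set_Cons_def dest: ne)
qed

section \<open>Projections of conjunctive sequence expressions\<close>

lemma Meet_list_mem: "Es \<noteq> [] \<Longrightarrow> has_type t (Meet_list Es) \<longleftrightarrow> (\<forall>E\<in>set Es. has_type t E)"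
  by (induction Es rule: Meet_list.induct) auto

lemma proj_mem:
  "\<Gamma> \<noteq> [] \<Longrightarrow> has_type t (proj \<Gamma> j) \<longleftrightarrow> (\<forall>\<gamma>\<in>set \<Gamma>. has_type t (components \<gamma> ! j))"
  by (simp add: proj_def Meet_list_mem)

text \<open>Non-emptiness excludes \<open>Min {}\<close> in \<open>conj_seq_length\<close> and the
  default value \<open>Top\<close> of \<open>Meet_list []\<close>.\<close>

definition wf_conj_seq :: "nat \<Rightarrow> 'c conj_seq \<Rightarrow> bool" where
  "wf_conj_seq n \<Gamma> \<longleftrightarrow> \<Gamma> \<noteq> [] \<and> (\<forall>\<gamma>\<in>set \<Gamma>. length (components \<gamma>) = n)"

lemma args_expr_DNF_wf:
  "wf_conj C \<Longrightarrow> \<Gamma> \<in> seq_DNF (args_expr f C) \<Longrightarrow> wf_conj_seq (ar f) \<Gamma>"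
  unfolding wf_conj_seq_def wf_conj_def
  using seq_DNF_arity[OF args_expr_arity] args_expr_DNF_nonempty by blast

lemma wf_conj_seq_length: "wf_conj_seq n \<Gamma> \<Longrightarrow> conj_seq_length \<Gamma> = n"
proof -
  assume "wf_conj_seq n \<Gamma>"
  then have "(\<lambda>\<gamma>. length (components \<gamma>)) ` set \<Gamma> = {n}"
    by (auto simp: wf_conj_seq_def image_iff) (metis list.set_sel(1))
  then show ?thesis by (simp add: conj_seq_length_def)
qed

text \<open>An intersection of products is the product of the componentwise intersections.
  \<open>Lam\<close> must be excluded separately: it has no components, so the condition on
  components cannot detect it.\<close>

lemma wf_conj_seq_mem:
  assumes "wf_conj_seq n \<Gamma>" "length ts = n"
  shows "(\<forall>\<gamma>\<in>set \<Gamma>. seq_mem ts \<gamma>) \<longleftrightarrow> Lam \<notin> set \<Gamma> \<and> (\<forall>j<n. has_type (ts ! j) (proj \<Gamma> j))"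
proof -
  have "seq_mem ts \<gamma> \<longleftrightarrow> \<gamma> \<noteq> Lam \<and> (\<forall>j<n. has_type (ts ! j) (components \<gamma> ! j))"
    if "\<gamma> \<in> set \<Gamma>" for \<gamma>
  proof -
    from that assms have "length (components \<gamma>) = length ts" by (simp add: wf_conj_seq_def)
    with assms(2) show ?thesis by (cases \<gamma>) (auto simp: list_all2_conv_all_nth)
  qed
  with assms(1) show ?thesis
    by (auto simp: wf_conj_seq_def proj_mem)
qed

lemma wf_conj_seq_Lam: "wf_conj_seq n \<Gamma> \<Longrightarrow> Lam \<in> set \<Gamma> \<Longrightarrow> n = 0"
  by (auto simp: wf_conj_seq_def)

lemma root_syms_Sig:
  assumes "wf_conj C" "f \<in> (\<Inter>\<alpha>\<in>pos C. root_syms \<alpha>)"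
  shows "f \<in> Sig"
  using assms ground_Sig by (fastforce simp: wf_conj_def root_syms_def)

lemma conj_mem_root_syms:
  assumes "wf_conj C" "conj_mem (Fun f ts) C"
  shows "f \<in> (\<Inter>\<alpha>\<in>pos C. root_syms \<alpha>)"
proof
  fix \<alpha> assume "\<alpha> \<in> pos C"
  with assms have "is_atomic \<alpha>" "has_type (Fun f ts) \<alpha>" by (auto simp: wf_conj_def conj_mem_def)
  then show "f \<in> root_syms \<alpha>"
    by (auto simp: has_type_atomic arg_seqs_def root_syms_def)
qed


section \<open>Soundness and completeness of the algorithm\<close>

definition refuted :: "'c conj set \<Rightarrow> 'f trm \<Rightarrow> bool" where
  "refuted \<Psi> t \<longleftrightarrow> (\<exists>C\<in>\<Psi>. \<exists>s. conj_mem s C \<and> size s \<le> size t)"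

text \<open>A successful \<open>eseq_conj\<close> call only guarantees one empty projection, so the
  statements on tuples yield one refuted entry. This entry is a proper subterm, and the strict drop
  in size allows \<open>C\<close> to be discharged from the hypotheses.\<close>

lemma sound:
  "etype E \<Psi> \<Longrightarrow> has_type t E \<Longrightarrow> refuted \<Psi> t"
  "etype_conj C \<Psi> \<Longrightarrow> wf_conj C \<Longrightarrow> conj_mem t C \<Longrightarrow> refuted \<Psi> t"
  "eseq \<Theta> \<Psi> \<Longrightarrow> \<forall>\<Gamma>\<in>seq_DNF \<Theta>. wf_conj_seq (length ts) \<Gamma> \<Longrightarrow> sexp_mem ts \<Theta> \<Longrightarrow>
    \<exists>t\<in>set ts. refuted \<Psi> t"
  "eseq_conj \<Gamma> \<Psi> \<Longrightarrow> wf_conj_seq (length ts) \<Gamma> \<Longrightarrow> \<forall>\<gamma>\<in>set \<Gamma>. seq_mem ts \<gamma> \<Longrightarrow>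
    \<exists>t\<in>set ts. refuted \<Psi> t"
proof (induction E \<Psi> and C \<Psi> and \<Theta> \<Psi> and \<Gamma> \<Psi> arbitrary: t and t and ts and ts
    rule: etype_etype_conj_eseq_eseq_conj.induct)
  case (1 E \<Psi>)
  from "1.prems"(2) obtain C where "C \<in> DNF E" "conj_mem t C" using DNF_mem by blast
  with 1 show ?case by (simp add: etype.simps DNF_wf)
next
  case (2 C \<Psi>)
  from "2.prems"(3) have disj: "pos C \<inter> neg C = {}" by (auto simp: conj_mem_def)
  show ?case
  proof (cases "\<exists>C'\<in>\<Psi>. C \<preceq> C'")
    case True
    \<comment> \<open>The term \<open>t\<close> itself is an element of \<open>C'\<close>, attaining
      the non-strict bound in \<open>refuted\<close>.\<close>
    with "2.prems"(3) show ?thesis by (auto simp: refuted_def dest: conj_mem_le)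
  next
    case False
    obtain s where s: "conj_mem s C" "\<And>s'. conj_mem s' C \<Longrightarrow> size s \<le> size s'"
      using arg_min_nat_lemma[of "\<lambda>s. conj_mem s C" t size] "2.prems"(3) by blast
    obtain f ts where fts: "s = Fun f ts" by (cases s)
    with s(1) have trm: "Fun f ts \<in> terms" by (simp add: conj_mem_def)
    \<comment> \<open>The root symbol of \<open>s\<close> is among those tested, so the recursive
      call for it must have succeeded.\<close>
    have f: "f \<in> (\<Inter>\<alpha>\<in>pos C. root_syms \<alpha>)"
      using conj_mem_root_syms[OF "2.prems"(2)] s(1) fts by blast
    have "eseq (args_expr f C) (\<Psi> \<union> {C})"
      using "2.prems"(1) disj False f by (simp add: etype_conj.simps)
    moreover have "\<forall>\<Gamma>\<in>seq_DNF (args_expr f C). wf_conj_seq (length ts) \<Gamma>"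
      using args_expr_DNF_wf[OF "2.prems"(2)] trm by (simp add: Fun_terms_iff)
    moreover have "sexp_mem ts (args_expr f C)"
      using args_expr_mem[OF "2.prems"(2) trm] s(1) fts by simp
    ultimately obtain u where u: "u \<in> set ts" "refuted (\<Psi> \<union> {C}) u"
      using "2.IH"[OF _ False f] disj by blast
    from u(1) have "size u < size s"
      by (simp add: fts less_Suc_eq_le size_list_estimation')
    \<comment> \<open>An element of \<open>C\<close> no larger than \<open>u\<close> would
      contradict the minimality of \<open>s\<close>. So the refuting conjunction lies in
      \<open>\<Psi>\<close>, with an element smaller than \<open>s\<close> and hence than
      \<open>t\<close>.\<close>
    with u(2) s "2.prems"(3) show ?thesis
      unfolding refuted_def by (fastforce dest: s(2))
  qed
next
  case (3 \<Theta> \<Psi>)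
  from "3.prems"(3) obtain \<Gamma> where "\<Gamma> \<in> seq_DNF \<Theta>" "\<forall>\<gamma>\<in>set \<Gamma>. seq_mem ts \<gamma>"
    using seq_DNF_mem by blast
  with 3 show ?case by (simp add: eseq.simps)
next
  case (4 \<Gamma> \<Psi>)
  note len = wf_conj_seq_length[OF "4.prems"(2)]
  from "4.prems" have mem: "Lam \<notin> set \<Gamma>" "\<forall>j<length ts. has_type (ts ! j) (proj \<Gamma> j)"
    using wf_conj_seq_mem by blast+
  \<comment> \<open>Without \<open>Lam\<close>, length 0 would make the call return false, so a
    position \<open>j\<close> exists.\<close>
  with "4.prems"(1) obtain j where j: "j < conj_seq_length \<Gamma>" "etype (proj \<Gamma> j) \<Psi>"
    by (auto simp: eseq_conj.simps split: if_splits)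
  then have "refuted \<Psi> (ts ! j)"
    using "4.IH"[of j "ts ! j"] mem len by fastforce
  with j len show ?case by (metis nth_mem)
qed

text \<open>The set \<open>\<Psi>\<close> can only turn calls true, so a failure yields an element
  whatever \<open>\<Psi>\<close> is. Failures originate at sequences of length 0 without
  \<open>Lam\<close>, that is, at constants.\<close>

lemma complete:
  "\<not> etype E \<Psi> \<Longrightarrow> \<exists>t. has_type t E"
  "\<not> etype_conj C \<Psi> \<Longrightarrow> wf_conj C \<Longrightarrow> \<exists>t. conj_mem t C"
  "\<not> eseq \<Theta> \<Psi> \<Longrightarrow> \<forall>\<Gamma>\<in>seq_DNF \<Theta>. wf_conj_seq n \<Gamma> \<Longrightarrow>
    \<exists>ts. length ts = n \<and> set ts \<subseteq> terms \<and> sexp_mem ts \<Theta>"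
  "\<not> eseq_conj \<Gamma> \<Psi> \<Longrightarrow> wf_conj_seq n \<Gamma> \<Longrightarrow>
    \<exists>ts. length ts = n \<and> set ts \<subseteq> terms \<and> (\<forall>\<gamma>\<in>set \<Gamma>. seq_mem ts \<gamma>)"
proof (induction E \<Psi> and C \<Psi> and \<Theta> \<Psi> and \<Gamma> \<Psi> arbitrary: and and n and n
    rule: etype_etype_conj_eseq_eseq_conj.induct)
  case (1 E \<Psi>)
  then obtain C where "C \<in> DNF E" "\<not> etype_conj C \<Psi>" by (auto simp: etype.simps)
  with "1.IH" DNF_wf DNF_mem show ?case by blast
next
  case (2 C \<Psi>)
  then obtain f where disj: "\<not> pos C \<inter> neg C \<noteq> {}" and new: "\<not> (\<exists>C'\<in>\<Psi>. C \<preceq> C')"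
    and f: "f \<in> (\<Inter>\<alpha>\<in>pos C. root_syms \<alpha>)" and fail: "\<not> eseq (args_expr f C) (\<Psi> \<union> {C})"
    by (auto simp: etype_conj.simps split: if_splits)
  obtain ts where "length ts = ar f" "set ts \<subseteq> terms" "sexp_mem ts (args_expr f C)"
    using "2.IH"[OF disj new f fail] args_expr_DNF_wf[OF "2.prems"(2)] by blast
  moreover have "f \<in> Sig" using root_syms_Sig[OF "2.prems"(2) f] .
  ultimately show ?case
    using args_expr_mem[OF "2.prems"(2), of f ts] by (auto simp: Fun_terms_iff)
next
  case (3 \<Theta> \<Psi>)
  then obtain \<Gamma> where "\<Gamma> \<in> seq_DNF \<Theta>" "\<not> eseq_conj \<Gamma> \<Psi>" by (auto simp: eseq.simps)
  with 3 seq_DNF_mem show ?case by blast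
next
  case (4 \<Gamma> \<Psi>)
  note len = wf_conj_seq_length[OF "4.prems"(2)]
  \<comment> \<open>An occurrence of \<open>Lam\<close> would force length 0, where the call returns
    true.\<close>
  have Lam: "Lam \<notin> set \<Gamma>"
    using "4.prems"(1) wf_conj_seq_Lam[OF "4.prems"(2)] len
    by (auto simp: eseq_conj.simps)
  have "\<exists>t. has_type t (proj \<Gamma> j)" if j: "j < n" for j
    using "4.prems"(1) "4.IH"[of j] Lam j len by (auto simp: eseq_conj.simps split: if_splits)
  \<comment> \<open>Every projection fails separately, so the entries of the tuple can be chosen
    independently; for \<open>n = 0\<close> the tuple is empty.\<close>
  then obtain t where t: "\<And>j. j < n \<Longrightarrow> has_type (t j) (proj \<Gamma> j)" by metis
  have "\<forall>\<gamma>\<in>set \<Gamma>. seq_mem (map t [0..<n]) \<gamma>"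
    using wf_conj_seq_mem[OF "4.prems"(2)] Lam t by simp
  moreover have "set (map t [0..<n]) \<subseteq> terms" using has_type_terms[OF t] by auto
  ultimately show ?case by (intro exI[of _ "map t [0..<n]"]) simp
qed

theorem etype_iff_Empty: "etype E {} \<longleftrightarrow> Empty E"
  using sound(1)[of E "{}"] complete(1)[of E "{}"]
  by (auto simp: Empty_def meaning_def refuted_def)

end

theorem theorem1:
  fixes Sig :: "'f set" and ar :: "'f \<Rightarrow> nat"
    and Tc :: "'c set" and tar :: "'c \<Rightarrow> nat"
    and \<Delta> :: "('c, 'f, 'v) rule set" and E :: "'c texp"
  assumes "type_system Sig ar Tc tar \<Delta>"
    and "E \<in> type_system.type_exprs Tc tar"
  shows "type_system.etype Sig ar Tc tar \<Delta> E {} \<longleftrightarrow> type_system.Empty Sig ar Tc tar \<Delta> E"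
  using assms(1) by (rule type_system.etype_iff_Empty)

end
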